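(* Let $d \ge 1$ be an integer and let $G$ be a graph of order $n \ge 2d+1$ whose complement $\overline{G}$ is $d$-degenerate. Then \[ \Gamma_d(G) \le 2d + 1 + 2\ln\!\left(\frac{n-2d+1}{2}\right). \]
   Context: A graph is $d$-degenerate if every induced subgraph of it has a vertex of degree at most $d$. $\ln$ is the natural logarithm. For a digraph $D$, a directed dominating set is a set $S \subseteq V(D)$ such that every vertex $u \notin S$ has a vertex $v \in S$ with arc $(v,u)$; $\gamma(D)$ is the minimum size of such a set. For a graph $G$, $\Gamma_d(G) = \max\{\gamma(D) : D \text{ an orientation of } G\}$. *)

theory Defs
  imports Complex_Main "Graph_Theory.Digraph_Component"
begin

text \<open>
  A finite simple graph is a \<open>pair_graph\<close>, i.e. a finite, loop-free, symmetric arc set in which the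
  edge \<open>uv\<close> appears as the two arcs \<open>(u, v)\<close> and \<open>(v, u)\<close>. The degree of a vertex is thus its
  \<open>out_degree\<close>.
\<close>

definition compl_graph :: "'a pair_pre_digraph \<Rightarrow> 'a pair_pre_digraph" where
  "compl_graph G =
    \<lparr> pverts = pverts G,
      parcs = {(u, v). u \<in> pverts G \<and> v \<in> pverts G \<and> u \<noteq> v \<and> (u, v) \<notin> parcs G} \<rparr>"

text \<open>Only nonempty induced subgraphs are considered: the empty one has no vertex at all.\<close>

definition degenerate :: "nat \<Rightarrow> 'a pair_pre_digraph \<Rightarrow> bool" where
  "degenerate d G \<longleftrightarrow>
    (\<forall>H. induced_subgraph H (with_proj G) \<and> verts H \<noteq> {} \<longrightarrow>
         (\<exists>v\<in>verts H. out_degree H v \<le> d))"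

definition orientation :: "'a pair_pre_digraph \<Rightarrow> 'a pair_pre_digraph \<Rightarrow> bool" where
  "orientation G D \<longleftrightarrow>
    pverts D = pverts G \<and> parcs D \<subseteq> parcs G \<and>
    (\<forall>(u, v)\<in>parcs G. (u, v) \<in> parcs D \<longleftrightarrow> (v, u) \<notin> parcs D)"

definition directed_dominating :: "'a pair_pre_digraph \<Rightarrow> 'a set \<Rightarrow> bool" where
  "directed_dominating D S \<longleftrightarrow>
    S \<subseteq> pverts D \<and> (\<forall>u\<in>pverts D - S. \<exists>v\<in>S. (v, u) \<in> parcs D)"

definition directed_dom_number :: "'a pair_pre_digraph \<Rightarrow> nat" where
  "directed_dom_number D = Min (card ` {S. directed_dominating D S})"

definition Gamma_d :: "'a pair_pre_digraph \<Rightarrow> nat" where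
  "Gamma_d G = Max (directed_dom_number ` {D. orientation G D})"

text \<open>The minimum and the maximum above range over finite nonempty sets.\<close>

lemma directed_dominating_finite_nonempty:
  assumes "finite (pverts D)"
  shows "finite {S. directed_dominating D S}" "{S. directed_dominating D S} \<noteq> {}"
proof -
  show "finite {S. directed_dominating D S}"
    by (rule finite_subset[of _ "Pow (pverts D)"]) (auto simp: directed_dominating_def assms)
  have "directed_dominating D (pverts D)"
    by (auto simp: directed_dominating_def)
  then show "{S. directed_dominating D S} \<noteq> {}" by blast
qed

lemma orientations_finite_nonempty:
  assumes "pair_graph G"
  shows "finite {D. orientation G D}" "{D. orientation G D} \<noteq> {}"
proof -
  interpret pair_graph G by fact
  have "{D. orientation G D} \<subseteq> (\<lambda>A. \<lparr> pverts = pverts G, parcs = A \<rparr>) ` Pow (parcs G)"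
  proof
    fix D :: "'a pair_pre_digraph" assume "D \<in> {D. orientation G D}"
    then have "D = \<lparr> pverts = pverts G, parcs = parcs D \<rparr>" "parcs D \<subseteq> parcs G"
      by (auto simp: orientation_def)
    then show "D \<in> (\<lambda>A. \<lparr> pverts = pverts G, parcs = A \<rparr>) ` Pow (parcs G)" by blast
  qed
  then show "finite {D. orientation G D}"
    by (rule finite_subset) (simp add: pair_finite_arcs)
  obtain f :: "'a \<Rightarrow> nat" where f: "inj_on f (pverts G)"
    using finite_imp_inj_to_nat_seg[OF pair_finite_verts] by blast
  have sym: "(v, u) \<in> parcs G" if "(u, v) \<in> parcs G" for u v
    using that pair_sym_arcs by (auto simp: symmetric_def dest: symD)
  have neq: "f u \<noteq> f v" if "(u, v) \<in> parcs G" for u v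
  proof -
    have "u \<in> pverts G" "v \<in> pverts G" "u \<noteq> v"
      using that arc_fst_in_verts[OF that] arc_snd_in_verts[OF that] pair_no_loops[OF that] by auto
    then show ?thesis using f by (auto dest: inj_onD)
  qed
  have "orientation G \<lparr> pverts = pverts G, parcs = {(u, v) \<in> parcs G. f u < f v} \<rparr>"
    using sym neq by (fastforce simp: orientation_def)
  then show "{D. orientation G D} \<noteq> {}" by blast
qed

end

theory Submission
  imports Defs
begin

text \<open>
  Greedy domination. A \<open>d\<close>-degenerate graph on \<open>k\<close> vertices has at most \<open>d k\<close> edges, so in any
  orientation of \<open>G\<close> every set of \<open>k\<close> vertices contains one that dominates at least
  \<open>(k - 1) / 2 - d\<close> others of the set. Discarding it together with the vertices it dominates at
  least halves \<open>k - 2 d + 1\<close>, and \<open>1 \<le> 2 ln 2\<close> pays for each step. Once at most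
  \<open>2 d\<close> vertices are left, all of them are taken.
\<close>

text \<open>Peel off a vertex of small degree and induct. \<open>N\<close> contains each edge in
  both orders, so every removal loses at most 2 d pairs.\<close>

lemma card_degenerate_relation_le:
  assumes "finite W" and "sym N"
    and "\<And>U. U \<subseteq> W \<Longrightarrow> U \<noteq> {} \<Longrightarrow> \<exists>v\<in>U. card (N `` {v} \<inter> U) \<le> d"
  shows "card (N \<inter> W \<times> W) \<le> 2 * d * card W"
  using assms(1,3)
proof (induction W rule: finite_psubset_induct)
  case (psubset W)
  show ?case
  proof (cases "W = {}")
    case False
    then obtain v where v: "v \<in> W" "card (N `` {v} \<inter> W) \<le> d"
      using psubset.prems by blast
    let ?X = "N `` {v} \<inter> W" and ?W = "W - {v}"
    have fin: "finite ?X" "finite (N \<inter> ?W \<times> ?W)" using psubset.hyps by auto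
    \<comment> \<open>The pairs lost with \<open>v\<close> lie in its row or its column; by symmetry
      both are indexed by \<open>?X\<close>.\<close>
    have "N \<inter> W \<times> W \<subseteq> N \<inter> ?W \<times> ?W \<union> ({v} \<times> ?X \<union> ?X \<times> {v})"
      using \<open>sym N\<close> by (auto dest: symD)
    then have "card (N \<inter> W \<times> W) \<le> card (N \<inter> ?W \<times> ?W \<union> ({v} \<times> ?X \<union> ?X \<times> {v}))"
      using fin by (intro card_mono) auto
    also have "\<dots> \<le> card (N \<inter> ?W \<times> ?W) + (card ({v} \<times> ?X) + card (?X \<times> {v}))"
      by (intro order_trans[OF card_Un_le] add_left_mono card_Un_le)
    also have "\<dots> \<le> 2 * d * card ?W + 2 * d"
    proof -
      have "card (N \<inter> ?W \<times> ?W) \<le> 2 * d * card ?W"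
        using v(1) psubset.prems by (intro psubset.IH) auto
      then show ?thesis using v(2) by (simp add: card_cartesian_product)
    qed
    also have "\<dots> = 2 * d * card W"
      using card_Suc_Diff1[OF psubset.hyps v(1)] by (metis mult_Suc_right add.commute)
    finally show ?thesis .
  qed simp
qed

text \<open>Averaging: arcs, reversed arcs, non-edges and the diagonal cover all ordered pairs of
  \<open>W\<close>. With k vertices and a arcs inside \<open>W\<close> this gives k * k \<le> 2 a +
  2 d k + k, and some out-degree within \<open>W\<close> is at least a / k.\<close>

lemma exists_large_out_neighbourhood:
  assumes "finite W" and "W \<noteq> {}"
    and total: "W \<times> W \<subseteq> A \<union> A\<inverse> \<union> N \<union> Id"
    and N: "card (N \<inter> W \<times> W) \<le> 2 * d * card W"
  shows "\<exists>v\<in>W. card W \<le> 2 * card (A `` {v} \<inter> W) + 2 * d + 1"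
proof (rule ccontr)
  assume "\<not> ?thesis"
  then have small: "2 * card (A `` {v} \<inter> W) + (2 * d + 1) < card W" if "v \<in> W" for v
    using that by force
  let ?A = "A \<inter> W \<times> W" and ?N = "N \<inter> W \<times> W"
  have "card ?A = card (SIGMA v:W. A `` {v} \<inter> W)"
    by (rule arg_cong[where f = card]) auto
  also have "\<dots> = (\<Sum>v\<in>W. card (A `` {v} \<inter> W))"
    using \<open>finite W\<close> by simp
  finally have A: "card ?A = (\<Sum>v\<in>W. card (A `` {v} \<inter> W))" .
  have "card W * card W = card (W \<times> W)"
    by (simp add: card_cartesian_product)
  also have "\<dots> \<le> card ((?A \<union> ?A\<inverse>) \<union> (?N \<union> Id_on W))"
    using total \<open>finite W\<close> by (intro card_mono) (auto simp: Id_on_def)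
  also have "\<dots> \<le> (card ?A + card (?A\<inverse>)) + (card ?N + card (Id_on W))"
    by (intro order_trans[OF card_Un_le] add_mono card_Un_le)
  also have "\<dots> \<le> 2 * card ?A + (2 * d * card W + card W)"
  proof -
    have "Id_on W = (\<lambda>x. (x, x)) ` W" by auto
    then have "card (Id_on W) \<le> card W" using card_image_le \<open>finite W\<close> by metis
    then show ?thesis using N by simp
  qed
  also have "\<dots> = (\<Sum>v\<in>W. 2 * card (A `` {v} \<inter> W) + (2 * d + 1))"
    unfolding A sum.distrib sum_distrib_left by simp
  also have "\<dots> < (\<Sum>v\<in>W. card W)"
    using assms(1,2) small by (intro sum_strict_mono) auto
  finally show False by simp
qed

lemma ln_2_ge_half: "1 / 2 \<le> ln (2 :: real)"
  \<comment> \<open>The bound ln (1 + x) \<le> x at x = -1/2 reads - ln 2 \<le> -1/2.\<close>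
  using ln_add_one_self_le_self2[of "- 1 / 2 :: real"] by (simp add: ln_div)

text \<open>Induction along the greedy choice. The lower bound on \<open>card W\<close> makes the
  argument of the logarithm at least 1, so the logarithmic term is nonnegative when the recursion
  stops.\<close>

lemma exists_small_dominating_subset:
  assumes "finite W" and "2 * d + 1 \<le> card W" and "irrefl A"
    and "\<And>U. U \<subseteq> W \<Longrightarrow> U \<noteq> {} \<Longrightarrow>
           \<exists>v\<in>U. card U \<le> 2 * card (A `` {v} \<inter> U) + 2 * d + 1"
  shows "\<exists>S\<subseteq>W. W - S \<subseteq> A `` S \<and>
           real (card S) \<le> 2 * real d + 1 + 2 * ln ((real (card W) - 2 * real d + 1) / 2)"
  using assms(1,2,4)
proof (induction W rule: finite_psubset_induct)
  case (psubset W)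
  let ?b = "\<lambda>k. 2 * real d + 1 + 2 * ln ((k - 2 * real d + 1) / 2)"
  have "W \<noteq> {}" using psubset.prems(1) by auto
  then obtain v where v: "v \<in> W" and large: "card W \<le> 2 * card (A `` {v} \<inter> W) + 2 * d + 1"
    using psubset.prems(2) by blast
  define U where "U = W - insert v (A `` {v})"
  have "U \<subset> W" and "finite U"
    using v psubset.hyps by (auto simp: U_def)
  \<comment> \<open>Thus \<open>v\<close> counts in addition to its out-neighbours among the
    discarded vertices; the exact halving below needs this extra one.\<close>
  have "v \<notin> A `` {v} \<inter> W"
    using \<open>irrefl A\<close> by (auto simp: irrefl_def)
  moreover have "W = insert v (A `` {v} \<inter> W) \<union> U" and "insert v (A `` {v} \<inter> W) \<inter> U = {}"
    using v by (auto simp: U_def)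
  then have "card W = card (insert v (A `` {v} \<inter> W)) + card U"
    using psubset.hyps \<open>finite U\<close> card_Un_disjoint[of "insert v (A `` {v} \<inter> W)" U] by simp
  ultimately have "card W = Suc (card (A `` {v} \<inter> W)) + card U"
    using psubset.hyps by simp
  \<comment> \<open>Equivalent to 2 (u - 2 d + 1) \<le> w - 2 d + 1 over the integers, where u and w
    are the sizes of \<open>U\<close> and \<open>W\<close>.\<close>
  with large have half: "2 * card U + 1 \<le> card W + 2 * d"
    by simp
  \<comment> \<open>Everything in \<open>W\<close> outside \<open>U\<close> is \<open>v\<close> or
    dominated by \<open>v\<close>. This serves both cases: \<open>S\<close> from the induction
    hypothesis, and \<open>S\<close> equal to \<open>U\<close>.\<close>
  have insert_ok: "insert v S \<subseteq> W \<and> W - insert v S \<subseteq> A `` insert v S"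
    if "S \<subseteq> U" "U - S \<subseteq> A `` S" for S
    using that v by (auto simp: U_def)
  show ?case
  proof (cases "2 * d + 1 \<le> card U")
    case True
    then obtain S where S: "S \<subseteq> U" "U - S \<subseteq> A `` S" "real (card S) \<le> ?b (real (card U))"
      using psubset.IH[OF \<open>U \<subset> W\<close>] psubset.prems(2) \<open>U \<subset> W\<close> by (meson psubset_imp_subset subset_trans)
    let ?x = "(real (card W) - 2 * real d + 1) / 2"
    have "0 < real (card U) - 2 * real d + 1" "real (card U) - 2 * real d + 1 \<le> ?x"
      using True half by (auto simp: field_simps)
    \<comment> \<open>Halving the argument lowers the bound by 2 ln 2 \<ge> 1, the price of
      \<open>v\<close>.\<close>
    then have "ln ((real (card U) - 2 * real d + 1) / 2) \<le> ln (?x / 2)"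
      by simp
    also have "\<dots> = ln ?x - ln 2"
      using psubset.prems(1) by (subst ln_div) auto
    finally have "real (card S) + 1 \<le> ?b (real (card W))"
      using S(3) ln_2_ge_half by simp
    moreover have "card (insert v S) \<le> card S + 1"
      by (simp add: card_insert_le_m1)
    ultimately show ?thesis
      using insert_ok[OF S(1,2)] by (intro exI[of _ "insert v S"]) linarith
  next
    case False
    \<comment> \<open>At most 2 d leftover vertices and the last greedy choice \<open>v\<close> make
      up the constant term.\<close>
    have "card (insert v U) \<le> 2 * d + 1"
      using False \<open>finite U\<close> by (simp add: card_insert_if)
    moreover have "0 \<le> ln ((real (card W) - 2 * real d + 1) / 2)"
      using psubset.prems(1) by (intro ln_ge_zero) auto
    ultimately have "real (card (insert v U)) \<le> ?b (real (card W))"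
      by linarith
    then show ?thesis
      using insert_ok[of U] by blast
  qed
qed

text \<open>Passes from out-degrees in induced subgraphs to the relational form used for counting:
  in the subgraph induced on \<open>U\<close>, the arcs leaving \<open>v\<close> correspond to its
  neighbours in \<open>U\<close>.\<close>

lemma degenerate_exists_small_neighbourhood:
  assumes "pair_wf_digraph H" and "degenerate d H" and "U \<subseteq> pverts H" and "U \<noteq> {}"
  shows "\<exists>v\<in>U. card (parcs H `` {v} \<inter> U) \<le> d"
proof -
  interpret pair_wf_digraph H by fact
  let ?K = "with_proj H \<restriction> U"
  have "induced_subgraph ?K (with_proj H)"
    using assms(3) by (intro induced_induce) simp
  then obtain v where v: "v \<in> U" "out_degree ?K v \<le> d"
    using assms(2,4) unfolding degenerate_def by (metis induce_subgraph_verts)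
  have "out_arcs ?K v = Pair v ` (parcs H `` {v} \<inter> U)"
    using v(1) by (auto simp: out_arcs_def)
  then have "out_degree ?K v = card (parcs H `` {v} \<inter> U)"
    unfolding out_degree_def by (simp add: card_image inj_on_def)
  with v show ?thesis by auto
qed

theorem theorem2p6:
  fixes G :: "'a pair_pre_digraph" and d n :: nat
  assumes "d \<ge> 1"
    and "pair_graph G"
    and "card (pverts G) = n"
    and "n \<ge> 2 * d + 1"
    and "degenerate d (compl_graph G)"
  shows "real (Gamma_d G) \<le> 2 * real d + 1 + 2 * ln ((real n - 2 * real d + 1) / 2)"
proof -
  interpret pair_graph G by fact
  let ?N = "parcs (compl_graph G)"
  have symG: "(v, u) \<in> parcs G" if "(u, v) \<in> parcs G" for u v
    using that pair_sym_arcs by (auto simp: symmetric_def dest: symD)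
  have "sym ?N"
    using symG by (auto simp: compl_graph_def intro!: symI)
  have wf: "pair_wf_digraph (compl_graph G)"
    by unfold_locales (auto simp: compl_graph_def)
  have edges: "card (?N \<inter> U \<times> U) \<le> 2 * d * card U" if "U \<subseteq> pverts G" for U
  proof (rule card_degenerate_relation_le)
    show "finite U" using that pair_finite_verts finite_subset by blast
    show "\<exists>v\<in>X. card (?N `` {v} \<inter> X) \<le> d" if "X \<subseteq> U" "X \<noteq> {}" for X
      using that \<open>U \<subseteq> pverts G\<close>
      by (intro degenerate_exists_small_neighbourhood[OF wf assms(5)]) (auto simp: compl_graph_def)
  qed fact
  have bound: "real (directed_dom_number D)
      \<le> 2 * real d + 1 + 2 * ln ((real n - 2 * real d + 1) / 2)" if D: "orientation G D" for D
  proof -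
    have V: "pverts D = pverts G" using D by (simp add: orientation_def)
    have "irrefl (parcs D)"
      using D pair_no_loops by (fastforce simp: orientation_def irrefl_def)
    moreover have "\<exists>v\<in>U. card U \<le> 2 * card (parcs D `` {v} \<inter> U) + 2 * d + 1"
      if "U \<subseteq> pverts G" "U \<noteq> {}" for U
    proof (rule exists_large_out_neighbourhood)
      show "finite U" using that pair_finite_verts finite_subset by blast
      \<comment> \<open>Distinct vertices are either adjacent in the complement or joined by an edge
        of \<open>G\<close>, which \<open>D\<close> orients one way or the other.\<close>
      show "U \<times> U \<subseteq> parcs D \<union> (parcs D)\<inverse> \<union> ?N \<union> Id"
        using D that by (fastforce simp: orientation_def compl_graph_def)
    qed (use that edges in auto)
    ultimately obtain S where S: "S \<subseteq> pverts G" "pverts G - S \<subseteq> parcs D `` S"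
      "real (card S) \<le> 2 * real d + 1 + 2 * ln ((real n - 2 * real d + 1) / 2)"
      using exists_small_dominating_subset[of "pverts G" d "parcs D"] assms(3,4) pair_finite_verts
      by auto
    have "directed_dominating D S"
      using S(1,2) by (auto simp: directed_dominating_def V)
    then have "directed_dom_number D \<le> card S"
      unfolding directed_dom_number_def
      using directed_dominating_finite_nonempty(1)[of D] pair_finite_verts
      by (intro Min_le) (auto simp: V)
    with S(3) show ?thesis by linarith
  qed
  \<comment> \<open>The maximum is attained by some orientation, so the uniform bound applies to
    it.\<close>
  have "Gamma_d G \<in> directed_dom_number ` {D. orientation G D}"
    unfolding Gamma_d_def using orientations_finite_nonempty[OF assms(2)] by (intro Max_in) auto
  then show ?thesis using bound by auto
qed

end
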